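(* Let $B_1$ and $B_2$ be bouquets (ribbon graphs with exactly one vertex) that have the same intersection graph, i.e. $I(B_1)=I(B_2)$ (after identifying their edge sets). Then \[{^\partial\varepsilon^{\times}_{B_1}(z)}={^\partial\varepsilon^{\times}_{B_2}(z)}.\]
   Context: A ribbon graph $G$ is a (possibly non-orientable) surface with boundary formed from vertex discs and edge discs (ribbons), each edge attached to vertex discs along two disjoint arcs. Let $v(G),e(G),f(G),c(G)$ be the numbers of vertices, edges, boundary components and connected components. The Euler genus is $\varepsilon(G)=2c(G)-v(G)+e(G)-f(G)$. For $A\subseteq E(G)$, the partial Petrial $G^{\times|A}$ is obtained from $G$ by adding a half-twist to each edge in $A$. The partial Petrial polynomial is ${^\partial\varepsilon^{\times}_{G}(z)}=\sum_{A\subseteq E(G)} z^{\varepsilon(G^{\times|A})}$. A bouquet is a ribbon graph with exactly one vertex. Two loops of a bouquet are interlaced if their ends alternate when travelling round the vertex boundary. The intersection graph $I(B)$ of a bouquet $B$ has vertex set $E(B)$, two vertices being adjacent iff the corresponding loops are interlaced. *)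

theory Defs
  imports "HOL-Computational_Algebra.Polynomial"
begin

text \<open>
  Ribbon graphs are encoded by signed rotation systems. Every vertex disc is given an
  orientation and a base point on its boundary; \<open>rot G v\<close> lists the edges whose ends are met
  when travelling once round the boundary of \<open>v\<close>, starting at the base point. An isolated
  vertex has the empty list. The set \<open>twisted G\<close> contains the ribbons that are attached with a
  half-twist relative to the chosen orientations of the vertex discs at their two ends.
  Every ribbon graph arises in this way.
\<close>

record ('v, 'e) rgraph =
  verts :: "'v set"
  rot :: "'v \<Rightarrow> 'e list"
  twisted :: "'e set"

definition edges :: "('v, 'e) rgraph \<Rightarrow> 'e set" where
  "edges G = (\<Union>v\<in>verts G. set (rot G v))"

text \<open>
  The pair \<open>(v, i)\<close> stands for the arc of the boundary of \<open>v\<close> along which the \<open>i\<close>-th edge end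
  in \<open>rot G v\<close> is attached.
\<close>

definition arcs :: "('v, 'e) rgraph \<Rightarrow> 'e \<Rightarrow> ('v \<times> nat) set" where
  "arcs G e = {(v, i). v \<in> verts G \<and> i < length (rot G v) \<and> rot G v ! i = e}"

definition ribbon_graph :: "('v, 'e) rgraph \<Rightarrow> bool" where
  "ribbon_graph G \<longleftrightarrow>
     finite (verts G) \<and> twisted G \<subseteq> edges G \<and> (\<forall>e\<in>edges G. card (arcs G e) = 2)"

text \<open>
  Removing the attaching arcs from the boundary of a vertex disc of degree \<open>n > 0\<close> leaves \<open>n\<close>
  segments; segment \<open>(v, i)\<close> is the one immediately before arc \<open>(v, i)\<close>, and the one
  immediately after that arc is \<open>(v, (i + 1) mod n)\<close>. For an isolated vertex the whole
  boundary circle is the single segment \<open>(v, 0)\<close>.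
\<close>

definition segments :: "('v, 'e) rgraph \<Rightarrow> ('v \<times> nat) set" where
  "segments G = {(v, i). v \<in> verts G \<and> i < max 1 (length (rot G v))}"

definition seg_before :: "('v, 'e) rgraph \<Rightarrow> 'v \<times> nat \<Rightarrow> 'v \<times> nat" where
  "seg_before G = (\<lambda>(v, i). (v, i))"

definition seg_after :: "('v, 'e) rgraph \<Rightarrow> 'v \<times> nat \<Rightarrow> 'v \<times> nat" where
  "seg_after G = (\<lambda>(v, i). (v, Suc i mod length (rot G v)))"

text \<open>
  Each of the two free sides of a ribbon joins two segments. If the ribbon is untwisted, the
  side leaving the start of one attaching arc arrives at the end of the other one, as in an
  annulus; if it is twisted, starts are joined to starts and ends to ends, as in a Moebius
  band. The boundary components of the surface are the classes of segments joined in this way.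
\<close>

definition side_rel :: "('v, 'e) rgraph \<Rightarrow> (('v \<times> nat) \<times> ('v \<times> nat)) set" where
  "side_rel G =
     {(seg_before G a, seg_after G b) | a b e.
        e \<in> edges G - twisted G \<and> a \<in> arcs G e \<and> b \<in> arcs G e \<and> a \<noteq> b} \<union>
     {(seg_before G a, seg_before G b) | a b e.
        e \<in> edges G \<inter> twisted G \<and> a \<in> arcs G e \<and> b \<in> arcs G e \<and> a \<noteq> b} \<union>
     {(seg_after G a, seg_after G b) | a b e.
        e \<in> edges G \<inter> twisted G \<and> a \<in> arcs G e \<and> b \<in> arcs G e \<and> a \<noteq> b}"

definition boundary_components :: "('v, 'e) rgraph \<Rightarrow> ('v \<times> nat) set set" where
  "boundary_components G = segments G // (side_rel G \<union> (side_rel G)\<inverse>)\<^sup>*"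

definition adj_rel :: "('v, 'e) rgraph \<Rightarrow> ('v \<times> 'v) set" where
  "adj_rel G =
     {(u, v). u \<in> verts G \<and> v \<in> verts G \<and> set (rot G u) \<inter> set (rot G v) \<noteq> {}}"

definition connected_components :: "('v, 'e) rgraph \<Rightarrow> 'v set set" where
  "connected_components G = verts G // (adj_rel G)\<^sup>*"

definition euler_genus :: "('v, 'e) rgraph \<Rightarrow> int" where
  "euler_genus G =
     2 * int (card (connected_components G)) - int (card (verts G))
       + int (card (edges G)) - int (card (boundary_components G))"

definition partial_petrial :: "('v, 'e) rgraph \<Rightarrow> 'e set \<Rightarrow> ('v, 'e) rgraph" where
  "partial_petrial G A = G\<lparr>twisted := (twisted G - A) \<union> (A - twisted G)\<rparr>"

text \<open>
  The Euler genus of a ribbon graph is nonnegative, so the conversion to \<open>nat\<close> loses nothing.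
\<close>

definition partial_petrial_poly :: "('v, 'e) rgraph \<Rightarrow> int poly" where
  "partial_petrial_poly G =
     (\<Sum>A\<in>Pow (edges G). monom 1 (nat (euler_genus (partial_petrial G A))))"

definition bouquet :: "('v, 'e) rgraph \<Rightarrow> bool" where
  "bouquet B \<longleftrightarrow> ribbon_graph B \<and> card (verts B) = 1"

definition occur_alternately :: "'e list \<Rightarrow> 'e \<Rightarrow> 'e \<Rightarrow> bool" where
  "occur_alternately w e f \<longleftrightarrow>
     (\<exists>i j k l. i < j \<and> j < k \<and> k < l \<and> l < length w \<and>
        w ! i = e \<and> w ! j = f \<and> w ! k = e \<and> w ! l = f)"

text \<open>
  Cutting the vertex boundary at the base point turns the cyclic pattern \<open>e f e f\<close> into either
  \<open>e f e f\<close> or \<open>f e f e\<close>.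
\<close>

definition interlaced :: "('v, 'e) rgraph \<Rightarrow> 'e \<Rightarrow> 'e \<Rightarrow> bool" where
  "interlaced B e f \<longleftrightarrow>
     e \<noteq> f \<and> (\<exists>v\<in>verts B. occur_alternately (rot B v) e f \<or> occur_alternately (rot B v) f e)"

text \<open>A simple graph is a pair of a vertex set and a set of two-element edge sets.\<close>

definition intersection_graph :: "('v, 'e) rgraph \<Rightarrow> 'e set \<times> 'e set set" where
  "intersection_graph B =
     (edges B, {{e, f} | e f. e \<in> edges B \<and> f \<in> edges B \<and> interlaced B e f})"

definition graph_isomorphism ::
    "('a \<Rightarrow> 'b) \<Rightarrow> 'a set \<times> 'a set set \<Rightarrow> 'b set \<times> 'b set set \<Rightarrow> bool" where
  "graph_isomorphism \<phi> G H \<longleftrightarrow>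
     bij_betw \<phi> (fst G) (fst H) \<and> snd H = (\<lambda>x. \<phi> ` x) ` snd G"

end

(*
  A set X of boundary segments that is a union of boundary components is a 0/1 labelling of the
  segments respected by every ribbon side. Recording at which arcs of the vertex boundary the
  label changes gives a set Y of edges, since the two ends of a ribbon always agree. Walking
  from one end of e to the other along the vertex boundary, the label changes as often as Y
  contains edges interlaced with e, up to an even number, so the condition imposed by e is
  that the row of e in the adjacency matrix of the intersection graph over GF(2), with diagonal
  entries 1 at twisted edges, annihilates Y. Together with the label of the base segment this
  gives 2 ^ f = 2 * |kernel|, so that f depends only on the intersection graph and the set of
  twisted edges. Partial Petrials run through all sets of twisted edges.
*)
theory Submission imports Defs "HOL-Library.FuncSet" begin

section \<open>Counting unions of equivalence classes\<close>

text \<open>A subset of \<open>S\<close> respected by \<open>r\<close> is a union of classes, so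
  \<open>Union\<close> and \<open_placeholder>

  The three entries above were broken off by a slip and are void; the complete list follows.\<close>

lemma card_saturated_subsets:
  assumes "finite S" and "equiv UNIV r" and closed: "r `` S \<subseteq> S"
  shows "card {X. X \<subseteq> S \<and> (\<forall>(s, t)\<in>r. s \<in> X \<longleftrightarrow> t \<in> X)} = 2 ^ card (S // r)"
proof -
  have refl: "(s, s) \<in> r" for s
    using assms(2) by (auto simp: equiv_def refl_on_def)
  have sym: "(s, t) \<in> r \<Longrightarrow> (t, s) \<in> r" for s t
    using assms(2) by (auto simp: equiv_def sym_def)
  have trans: "(s, t) \<in> r \<Longrightarrow> (t, u) \<in> r \<Longrightarrow> (s, u) \<in> r" for s t u
    using assms(2) by (meson equiv_def transD)
  have fin: "finite (S // r)"
    using assms(1) by (simp add: quotient_def)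
  have "bij_betw Union (Pow (S // r)) {X. X \<subseteq> S \<and> (\<forall>(s, t)\<in>r. s \<in> X \<longleftrightarrow> t \<in> X)}"
  proof (rule bij_betwI[where g = "\<lambda>X. X // r"])
    show "Union \<in> Pow (S // r) \<rightarrow> {X. X \<subseteq> S \<and> (\<forall>(s, t)\<in>r. s \<in> X \<longleftrightarrow> t \<in> X)}"
    proof (rule funcsetI, intro CollectI conjI)
      fix C assume C: "C \<in> Pow (S // r)"
      then show "\<Union>C \<subseteq> S"
        using closed by (auto simp: quotient_def)
      have "t \<in> \<Union>C" if st: "(s, t) \<in> r" "s \<in> \<Union>C" for s t
      proof -
        obtain x where "r `` {x} \<in> C" "(x, s) \<in> r"
          using C st(2) by (auto simp: quotient_def)
        then show ?thesis using trans[OF _ st(1)] by blast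
      qed
      then show "\<forall>(s, t)\<in>r. s \<in> \<Union>C \<longleftrightarrow> t \<in> \<Union>C"
        using sym by blast
    qed
    show "(\<lambda>X. X // r) \<in> {X. X \<subseteq> S \<and> (\<forall>(s, t)\<in>r. s \<in> X \<longleftrightarrow> t \<in> X)} \<rightarrow> Pow (S // r)"
      by (auto simp: quotient_def)
  next
    fix C assume C: "C \<in> Pow (S // r)"
    show "\<Union>C // r = C"
    proof (intro equalityI subsetI)
      fix c assume "c \<in> \<Union>C // r"
      then obtain s D where s: "D \<in> C" "s \<in> D" "c = r `` {s}"
        by (auto simp: quotient_def)
      then obtain x where "D = r `` {x}"
        using C by (auto simp: quotient_def)
      then have "c = D"
        using s sym trans by blast
      then show "c \<in> C" using s by simp
    next
      fix c assume c: "c \<in> C"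
      then obtain x where "c = r `` {x}"
        using C by (auto simp: quotient_def)
      then show "c \<in> \<Union>C // r"
        using c refl[of x] by (auto simp: quotient_def intro!: bexI[of _ "r `` {x}"] bexI[of _ x])
    qed
  next
    fix X assume "X \<in> {X. X \<subseteq> S \<and> (\<forall>(s, t)\<in>r. s \<in> X \<longleftrightarrow> t \<in> X)}"
    then show "\<Union>(X // r) = X"
      using refl by (auto simp: quotient_def)
  qed
  then show ?thesis
    using fin by (simp add: bij_betw_same_card[symmetric] card_Pow)
qed

text \<open>Agreement of membership is itself an equivalence relation, so it passes from generators
  to the closure. Saturation can thus be tested on single ribbon sides.\<close>

lemma saturated_rtrancl_iff:
  "(\<forall>(s, t)\<in>(R \<union> R\<inverse>)\<^sup>*. s \<in> X \<longleftrightarrow> t \<in> X) \<longleftrightarrow> (\<forall>(s, t)\<in>R. s \<in> X \<longleftrightarrow> t \<in> X)"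
proof
  assume *: "\<forall>(s, t)\<in>R. s \<in> X \<longleftrightarrow> t \<in> X"
  have "s \<in> X \<longleftrightarrow> t \<in> X" if "(s, t) \<in> (R \<union> R\<inverse>)\<^sup>*" for s t
    using that by (induction rule: rtrancl_induct) (use * in auto)
  then show "\<forall>(s, t)\<in>(R \<union> R\<inverse>)\<^sup>*. s \<in> X \<longleftrightarrow> t \<in> X" by blast
qed blast

lemma equiv_rtrancl_symcl: "equiv UNIV ((R \<union> R\<inverse>)\<^sup>*)"
  by (intro equivI refl_rtrancl sym_rtrancl trans_rtrancl) (auto simp: sym_def)

section \<open>Interlacement in words where every letter occurs twice\<close>

lemma interlaced_commute: "interlaced B e f \<longleftrightarrow> interlaced B f e"
  by (auto simp: interlaced_def)

lemma interlaced_imp_edges: "interlaced B e f \<Longrightarrow> e \<in> edges B \<and> f \<in> edges B"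
  by (force simp: interlaced_def occur_alternately_def edges_def)

text \<open>The kernel over GF(2) of the interlacement matrix with ones on the diagonal at twisted
  edges. Since no edge is interlaced with itself, the diagonal term stands separately on the
  right.\<close>

definition null_sets :: "('v, 'e) rgraph \<Rightarrow> 'e set set" where
  "null_sets B = {Y. Y \<subseteq> edges B \<and>
     (\<forall>e\<in>edges B. odd (card {f\<in>Y. interlaced B e f}) \<longleftrightarrow> e \<in> twisted B \<and> e \<in> Y)}"

text \<open>A bouquet read as a cyclic word \<open>w\<close> cut at the base point. The twisted set
  is left free, so that the results apply to all partial Petrials at once.\<close>

locale one_vertex =
  fixes B :: "('v, 'e) rgraph" and v :: 'v and w :: "'e list"
  assumes verts: "verts B = {v}" and rot: "rot B v = w"
    and twice: "\<And>e. e \<in> set w \<Longrightarrow> card {i. i < length w \<and> w ! i = e} = 2"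
begin

lemma edges_eq: "edges B = set w"
  by (simp add: edges_def verts rot)

lemma arcs_eq: "arcs B e = Pair v ` {i. i < length w \<and> w ! i = e}"
  by (auto simp: arcs_def verts rot)

lemma segments_eq: "segments B = Pair v ` {..<max 1 (length w)}"
  by (auto simp: segments_def verts rot)

lemma positions:
  assumes "e \<in> set w"
  obtains a b where "a < b" "b < length w" "{i. i < length w \<and> w ! i = e} = {a, b}"
proof -
  obtain a b where "{i. i < length w \<and> w ! i = e} = {a, b}" "a \<noteq> b"
    using twice[OF assms] by (auto simp: card_2_iff)
  then show ?thesis
    using that[of a b] that[of b a] by (cases a b rule: linorder_cases) (auto simp: doubleton_eq_iff)
qed

lemma interlaced_iff:
  "interlaced B e f \<longleftrightarrow> e \<noteq> f \<and> (occur_alternately w e f \<or> occur_alternately w f e)"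
  by (simp add: interlaced_def verts rot)

text \<open>A letter other than \<open>e\<close> occurs zero, one or two times between the two ends
  of \<open>e\<close>, and exactly once when the ends alternate. For \<open>f = e\<close> both sides
  are false.\<close>

lemma odd_between_iff_interlaced:
  assumes ab: "a < b" "{i. i < length w \<and> w ! i = e} = {a, b}" and f: "f \<in> set w"
  shows "odd (card {j \<in> {a<..<b}. w ! j = f}) \<longleftrightarrow> interlaced B e f"
proof (cases "f = e")
  case True
  have e: "i < length w \<and> w ! i = e \<longleftrightarrow> i = a \<or> i = b" for i
    using ab(2) by blast
  have "w ! j \<noteq> f" if "a < j" "j < b" for j
    using e[of j] e[of b] that True by auto
  then have none: "{j \<in> {a<..<b}. w ! j = f} = {}"
    by auto
  show ?thesis unfolding none using True by (simp add: interlaced_iff)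
next
  case False
  obtain c d where cd: "c < d" "{i. i < length w \<and> w ! i = f} = {c, d}"
    using positions[OF f] by metis
  have e: "i < length w \<and> w ! i = e \<longleftrightarrow> i = a \<or> i = b" for i
    using ab(2) by blast
  have f: "i < length w \<and> w ! i = f \<longleftrightarrow> i = c \<or> i = d" for i
    using cd(2) by blast
  have ne: "a \<noteq> c" "a \<noteq> d" "b \<noteq> c" "b \<noteq> d"
    using e f False by metis+
  have b: "b < length w" "d < length w" using e[of b] f[of d] by blast+
  have letters: "w ! a = e" "w ! b = e" "w ! c = f" "w ! d = f"
    using e[of a] e[of b] f[of c] f[of d] by blast+
  \<comment> \<open>Each letter has only two positions, so the four witnesses of an alternation are
    forced.\<close>
  have ef: "occur_alternately w e f \<longleftrightarrow> a < c \<and> c < b \<and> b < d" (is "?L \<longleftrightarrow> ?R")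
  proof
    assume ?L
    then obtain i j k l where ijkl: "i < j" "j < k" "k < l" "l < length w"
      "w ! i = e" "w ! j = f" "w ! k = e" "w ! l = f"
      by (auto simp: occur_alternately_def)
    then have "i = a \<or> i = b" "k = a \<or> k = b" "j = c \<or> j = d" "l = c \<or> l = d"
      using e[of i] e[of k] f[of j] f[of l] by auto
    then show ?R using ijkl ab(1) cd(1) by auto
  next
    assume ?R
    then show ?L unfolding occur_alternately_def
      using letters b by (intro exI[of _ a] exI[of _ c] exI[of _ b] exI[of _ d]) simp
  qed
  have fe: "occur_alternately w f e \<longleftrightarrow> c < a \<and> a < d \<and> d < b" (is "?L \<longleftrightarrow> ?R")
  proof
    assume ?L
    then obtain i j k l where ijkl: "i < j" "j < k" "k < l" "l < length w"
      "w ! i = f" "w ! j = e" "w ! k = f" "w ! l = e"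
      by (auto simp: occur_alternately_def)
    then have "i = c \<or> i = d" "k = c \<or> k = d" "j = a \<or> j = b" "l = a \<or> l = b"
      using f[of i] f[of k] e[of j] e[of l] by auto
    then show ?R using ijkl ab(1) cd(1) by auto
  next
    assume ?R
    then show ?L unfolding occur_alternately_def
      using letters b by (intro exI[of _ c] exI[of _ a] exI[of _ d] exI[of _ b]) simp
  qed
  have "{j \<in> {a<..<b}. w ! j = f} = {j. j \<in> {a<..<b} \<and> (j = c \<or> j = d)}"
  proof (rule Collect_cong, rule conj_cong)
    fix j assume "j \<in> {a<..<b}"
    then have "j < length w" using b(1) by simp
    then show "w ! j = f \<longleftrightarrow> j = c \<or> j = d" using f[of j] by blast
  qed simp
  also have "\<dots> = (if a < c \<and> c < b then {c} else {}) \<union> (if a < d \<and> d < b then {d} else {})"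
    by auto
  finally have "odd (card {j \<in> {a<..<b}. w ! j = f}) \<longleftrightarrow>
      (a < c \<and> c < b) \<noteq> (a < d \<and> d < b)"
    using cd(1) by auto
  \<comment> \<open>As \<open>c < d\<close>, exactly one of them lies between \<open>a\<close> and
    \<open>b\<close> iff \<open>c\<close> is inside and \<open>d\<close> beyond \<open>b\<close>, or
    \<open>d\<close> is inside and \<open>c\<close> before \<open>a\<close>. These are the two
    alternation patterns.\<close>
  then show ?thesis
    using False ef fe ne ab(1) cd(1) by (auto simp: interlaced_iff)
qed

section \<open>Parity of label changes along the vertex boundary\<close>

text \<open>The label of segment \<open>i\<close> relative to the base segment, if the label flips
  exactly at arcs of edges in \<open>Y\<close>. Segment \<open>i\<close> precedes arc
  \<open>i\<close>, hence the strict bound.\<close>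

definition change_parity :: "'e set \<Rightarrow> nat \<Rightarrow> bool" where
  "change_parity Y i \<longleftrightarrow> odd (card {j. j < i \<and> w ! j \<in> Y})"

lemma change_parity_0 [simp]: "\<not> change_parity Y 0"
  by (simp add: change_parity_def)

lemma change_parity_Suc [simp]:
  "change_parity Y (Suc i) \<longleftrightarrow> change_parity Y i \<noteq> (w ! i \<in> Y)"
proof -
  have "{j. j < Suc i \<and> w ! j \<in> Y} =
      (if w ! i \<in> Y then insert i {j. j < i \<and> w ! j \<in> Y} else {j. j < i \<and> w ! j \<in> Y})"
    by (auto simp: less_Suc_eq)
  then show ?thesis by (simp add: change_parity_def)
qed

lemma card_by_letter:
  assumes "finite J" "Y \<subseteq> set w"
  shows "card {j \<in> J. w ! j \<in> Y} = (\<Sum>f\<in>Y. card {j \<in> J. w ! j = f})"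
proof -
  have "{j \<in> J. w ! j \<in> Y} = (\<Union>f\<in>Y. {j \<in> J. w ! j = f})" by auto
  then show ?thesis
    using assms finite_subset[OF assms(2)] by (simp only:) (subst card_UN_disjoint; auto)
qed

text \<open>Every edge in \<open>Y\<close> contributes two flips, so a full turn restores the label;
  this makes a labelling of the circle possible for any \<open>Y\<close>.\<close>

lemma change_parity_length [simp]:
  assumes "Y \<subseteq> set w" shows "\<not> change_parity Y (length w)"
proof -
  have "card {j \<in> {..<length w}. w ! j \<in> Y} = (\<Sum>f\<in>Y. card {j \<in> {..<length w}. w ! j = f})"
    using assms by (intro card_by_letter) auto
  also have "\<dots> = (\<Sum>f\<in>Y. 2)"
    using assms twice by (intro sum.cong) auto
  finally show ?thesis by (simp add: change_parity_def)
qed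

lemma change_parity_mod:
  assumes "Y \<subseteq> set w" "i < length w"
  shows "change_parity Y (Suc i mod length w) \<longleftrightarrow> change_parity Y i \<noteq> (w ! i \<in> Y)"
proof (cases "Suc i = length w")
  case True
  then show ?thesis
    using change_parity_length[OF assms(1)] change_parity_Suc[of Y i] by simp
next
  case False
  then show ?thesis using assms by simp
qed

text \<open>The way from segment \<open>a\<close> to segment \<open>b\<close> crosses arc
  \<open>a\<close>, which flips iff \<open>e \<in> Y\<close>, and the arcs strictly between; among
  these a letter counts oddly iff it is interlaced with \<open>e\<close>.\<close>

lemma change_parity_between:
  assumes ab: "a < b" "{i. i < length w \<and> w ! i = e} = {a, b}" and Y: "Y \<subseteq> set w"
  shows "change_parity Y b \<longleftrightarrow>
    (change_parity Y a \<noteq> (e \<in> Y)) \<noteq> odd (card {f \<in> Y. interlaced B e f})"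
proof -
  have wa: "w ! a = e" using ab by auto
  have "{j. j < b \<and> w ! j \<in> Y} =
      {j. j < Suc a \<and> w ! j \<in> Y} \<union> {j \<in> {a<..<b}. w ! j \<in> Y}"
    using ab(1) by auto
  moreover have "card \<dots> = card {j. j < Suc a \<and> w ! j \<in> Y} + card {j \<in> {a<..<b}. w ! j \<in> Y}"
    by (rule card_Un_disjoint) auto
  ultimately have "change_parity Y b \<longleftrightarrow>
      change_parity Y (Suc a) \<noteq> odd (card {j \<in> {a<..<b}. w ! j \<in> Y})"
    by (simp only: change_parity_def) auto
  \<comment> \<open>Grouping by letters turns the count into a sum over \<open>Y\<close>, whose
    parity is that of the number of odd terms.\<close>
  moreover have "odd (card {j \<in> {a<..<b}. w ! j \<in> Y}) \<longleftrightarrow> odd (card {f \<in> Y. interlaced B e f})"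
  proof -
    have "{f \<in> Y. odd (card {j \<in> {a<..<b}. w ! j = f})} = {f \<in> Y. interlaced B e f}"
      using odd_between_iff_interlaced[OF ab] Y by auto
    then show ?thesis
      using even_sum_iff[OF finite_subset[OF Y], of "\<lambda>f. card {j \<in> {a<..<b}. w ! j = f}"] Y
      by (simp add: card_by_letter del: greaterThanLessThan_iff)
  qed
  ultimately show ?thesis using wa by simp
qed

section \<open>Saturated segment sets and the kernel\<close>

definition saturated :: "('v \<times> nat) set \<Rightarrow> bool" where
  "saturated X \<longleftrightarrow> (\<forall>(s, t)\<in>side_rel B. s \<in> X \<longleftrightarrow> t \<in> X)"

text \<open>Letting \<open>a\<close> and \<open>b\<close> appear in both orders covers the two free
  sides of an untwisted ribbon, each joining the start of one arc to the end of the other.\<close>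

lemma saturated_iff:
  "saturated X \<longleftrightarrow> (\<forall>e\<in>set w. \<forall>a b. a \<noteq> b \<longrightarrow> a < length w \<longrightarrow> w ! a = e \<longrightarrow>
     b < length w \<longrightarrow> w ! b = e \<longrightarrow>
     (if e \<in> twisted B
      then ((v, a) \<in> X \<longleftrightarrow> (v, b) \<in> X) \<and>
        ((v, Suc a mod length w) \<in> X \<longleftrightarrow> (v, Suc b mod length w) \<in> X)
      else ((v, a) \<in> X \<longleftrightarrow> (v, Suc b mod length w) \<in> X)))" (is "_ \<longleftrightarrow> ?R")
proof
  assume sat: "saturated X"
  show ?R
  proof (intro ballI allI impI)
    fix e a b
    assume *: "e \<in> set w" "a \<noteq> b" "a < length w" "w ! a = e" "b < length w" "w ! b = e"
    have arcs: "(v, a) \<in> arcs B e" "(v, b) \<in> arcs B e" "(v, a) \<noteq> (v, b)"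
      unfolding arcs_eq using * by blast+
    have T: "(seg_before B (v, a), seg_before B (v, b)) \<in> side_rel B"
      "(seg_after B (v, a), seg_after B (v, b)) \<in> side_rel B" if "e \<in> twisted B"
      using arcs that * unfolding side_rel_def edges_eq by blast+
    have U: "(seg_before B (v, a), seg_after B (v, b)) \<in> side_rel B" if "e \<notin> twisted B"
      using arcs that * unfolding side_rel_def edges_eq by blast
    show "if e \<in> twisted B
      then ((v, a) \<in> X \<longleftrightarrow> (v, b) \<in> X) \<and>
        ((v, Suc a mod length w) \<in> X \<longleftrightarrow> (v, Suc b mod length w) \<in> X)
      else ((v, a) \<in> X \<longleftrightarrow> (v, Suc b mod length w) \<in> X)"
      using sat T U by (auto simp: saturated_def seg_before_def seg_after_def rot)
  qed
next
  assume R: ?R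
  show "saturated X"
    unfolding saturated_def
    using R by (auto simp: side_rel_def edges_eq arcs_eq seg_before_def seg_after_def rot)
qed

text \<open>The segments labelled true when the base segment has label \<open>c\<close> and the
  flips occur at \<open>Y\<close>. The bound \<open>max 1\<close> keeps the single segment of an
  isolated vertex.\<close>

definition labelling :: "bool \<times> 'e set \<Rightarrow> ('v \<times> nat) set" where
  "labelling = (\<lambda>(c, Y). Pair v ` {i. i < max 1 (length w) \<and> c \<noteq> change_parity Y i})"

lemma labelling_iff:
  "i < max 1 (length w) \<Longrightarrow> (v, i) \<in> labelling (c, Y) \<longleftrightarrow> c \<noteq> change_parity Y i"
  by (auto simp: labelling_def)

lemma labelling_after:
  assumes "Y \<subseteq> set w" "i < length w"
  shows "(v, Suc i mod length w) \<in> labelling (c, Y) \<longleftrightarrow> ((v, i) \<in> labelling (c, Y)) \<noteq> (w ! i \<in> Y)"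
proof -
  have "Suc i mod length w < length w" using assms(2) by (intro mod_less_divisor) auto
  then show ?thesis
    using assms by (auto simp: labelling_iff change_parity_mod)
qed

text \<open>From segment \<open>a\<close> to segment \<open>b\<close> the label changes by
  \<open>[e \<in> Y] + ?Q e\<close> modulo 2. A twisted ribbon wants these labels equal, so
  \<open>?Q e\<close> must equal \<open>[e \<in> Y]\<close>. An untwisted one compares segment
  \<open>a\<close> with the segment after arc \<open>b\<close>, where a second flip at
  \<open>e\<close> cancels the first, so \<open>?Q e\<close> must vanish.\<close>

lemma saturated_labelling_iff:
  assumes Y: "Y \<subseteq> set w"
  shows "saturated (labelling (c, Y)) \<longleftrightarrow> Y \<in> null_sets B"
proof -
  let ?X = "labelling (c, Y)"
  let ?Q = "\<lambda>e. odd (card {f \<in> Y. interlaced B e f})"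
  have "(\<forall>a b. a \<noteq> b \<longrightarrow> a < length w \<longrightarrow> w ! a = e \<longrightarrow> b < length w \<longrightarrow> w ! b = e \<longrightarrow>
     (if e \<in> twisted B
      then ((v, a) \<in> ?X \<longleftrightarrow> (v, b) \<in> ?X) \<and>
        ((v, Suc a mod length w) \<in> ?X \<longleftrightarrow> (v, Suc b mod length w) \<in> ?X)
      else ((v, a) \<in> ?X \<longleftrightarrow> (v, Suc b mod length w) \<in> ?X))) \<longleftrightarrow>
     (?Q e \<longleftrightarrow> e \<in> twisted B \<and> e \<in> Y)" (is "?L \<longleftrightarrow> ?R") if e: "e \<in> set w" for e
  proof -
    obtain a b where ab: "a < b" "b < length w" "{i. i < length w \<and> w ! i = e} = {a, b}"
      using positions[OF e] by metis
    have pos: "i < length w \<and> w ! i = e \<longleftrightarrow> i = a \<or> i = b" for i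
      using ab(3) by blast
    have after: "(v, Suc i mod length w) \<in> ?X \<longleftrightarrow> ((v, i) \<in> ?X) \<noteq> (e \<in> Y)" if "i = a \<or> i = b" for i
      using labelling_after[OF Y, of i c] pos[of i] that by simp
    have ba: "(v, b) \<in> ?X \<longleftrightarrow> (((v, a) \<in> ?X) \<noteq> (e \<in> Y)) \<noteq> ?Q e"
      using ab change_parity_between[OF ab(1,3) Y] by (auto simp: labelling_iff)
    define C where "C a b \<longleftrightarrow> (if e \<in> twisted B
      then ((v, a) \<in> ?X \<longleftrightarrow> (v, b) \<in> ?X) \<and>
        ((v, Suc a mod length w) \<in> ?X \<longleftrightarrow> (v, Suc b mod length w) \<in> ?X)
      else ((v, a) \<in> ?X \<longleftrightarrow> (v, Suc b mod length w) \<in> ?X))" for a b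
    \<comment> \<open>Only the ordered pairs \<open>(a, b)\<close> and \<open>(b, a)\<close> satisfy
      the premises of the quantified condition.\<close>
    have "?L \<longleftrightarrow> C a b \<and> C b a"
      unfolding C_def[symmetric]
    proof (intro iffI allI impI)
      assume "\<forall>a b. a \<noteq> b \<longrightarrow> a < length w \<longrightarrow> w ! a = e \<longrightarrow> b < length w \<longrightarrow> w ! b = e \<longrightarrow> C a b"
      then show "C a b \<and> C b a"
        using ab(1) pos[of a] pos[of b] by simp
    next
      fix a' b'
      assume "C a b \<and> C b a" "a' \<noteq> b'"
        "a' < length w" "w ! a' = e" "b' < length w" "w ! b' = e"
      then show "C a' b'"
        using pos[of a'] pos[of b'] by auto
    qed
    also have "\<dots> \<longleftrightarrow> ?R"
      using after[of a] after[of b] ba by (auto simp: C_def)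
    finally show ?thesis .
  qed
  then show ?thesis
    unfolding saturated_iff null_sets_def edges_eq using Y by blast
qed

text \<open>The inverse reads off \<open>c\<close> at the base segment and \<open>Y\<close> from the
  arcs where membership changes.\<close>

lemma bij_betw_labelling:
  "bij_betw labelling (UNIV \<times> null_sets B) {X. X \<subseteq> segments B \<and> saturated X}"
proof (rule bij_betw_imageI)
  have sub: "Y \<subseteq> set w" if "Y \<in> null_sets B" for Y
    using that by (simp add: null_sets_def edges_eq)
  show "inj_on labelling (UNIV \<times> null_sets B)"
  proof (rule inj_onI, clarify)
    fix c Y c' Y'
    assume Y: "Y \<in> null_sets B" "Y' \<in> null_sets B" and eq: "labelling (c, Y) = labelling (c', Y')"
    have "c = c'"
      using eq labelling_iff[of 0 c Y] labelling_iff[of 0 c' Y'] by simp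
    moreover have "w ! i \<in> Y \<longleftrightarrow> w ! i \<in> Y'" if "i < length w" for i
      using labelling_after[OF sub[OF Y(1)] that, of c] labelling_after[OF sub[OF Y(2)] that, of c'] eq
      by auto
    then have "Y = Y'"
      using sub[OF Y(1)] sub[OF Y(2)] by (auto simp: in_set_conv_nth subset_iff; metis)
    ultimately show "c = c' \<and> Y = Y'" by blast
  qed
  show "labelling ` (UNIV \<times> null_sets B) = {X. X \<subseteq> segments B \<and> saturated X}"
  proof (intro equalityI subsetI)
    fix X assume "X \<in> labelling ` (UNIV \<times> null_sets B)"
    then show "X \<in> {X. X \<subseteq> segments B \<and> saturated X}"
      using saturated_labelling_iff sub by (auto simp: labelling_def segments_eq)
  next
    fix X assume X: "X \<in> {X. X \<subseteq> segments B \<and> saturated X}"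
    define change where "change i \<longleftrightarrow> ((v, i) \<in> X) \<noteq> ((v, Suc i mod length w) \<in> X)" for i
    define Y where "Y = {w ! i | i. i < length w \<and> change i}"
    define c where "c \<longleftrightarrow> (v, 0) \<in> X"
    \<comment> \<open>A twisted ribbon matches before with before and after with after; an untwisted
      one matches before with after in both orders. Either way both ends flip or neither does, so
      flipping is a property of the edge.\<close>
    have change_eq: "change i \<longleftrightarrow> change j"
      if "i < length w" "j < length w" "w ! i = w ! j" for i j
    proof (cases "i = j")
      case False
      have sat: "saturated X" using X by simp
      show ?thesis
        using sat[unfolded saturated_iff, rule_format, of "w ! j" i j]
          sat[unfolded saturated_iff, rule_format, of "w ! j" j i] that False
        unfolding change_def by (auto split: if_splits)
    qed simp
    have Y: "Y \<subseteq> set w" by (auto simp: Y_def)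
    have mem_Y: "w ! i \<in> Y \<longleftrightarrow> change i" if "i < length w" for i
    proof
      assume "w ! i \<in> Y"
      then obtain j where "w ! i = w ! j" "j < length w" "change j"
        unfolding Y_def by blast
      then show "change i" using change_eq[of i j] that by simp
    qed (use that in \<open>auto simp: Y_def\<close>)
    have label: "(v, i) \<in> X \<longleftrightarrow> c \<noteq> change_parity Y i" if "i < max 1 (length w)" for i
      using that
    proof (induction i)
      case 0
      then show ?case by (simp add: c_def)
    next
      case (Suc i)
      \<comment> \<open>The induction stops before the base point is reached again, so no wraparound
        occurs.\<close>
      then have "i < length w" "Suc i mod length w = Suc i" by auto
      then show ?case using Suc mem_Y[of i] by (auto simp: change_def)
    qed
    have "X = labelling (c, Y)"
      using X label by (auto simp: segments_eq labelling_def)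
    moreover from this have "Y \<in> null_sets B"
      using X saturated_labelling_iff[OF Y, of c] by simp
    ultimately show "X \<in> labelling ` (UNIV \<times> null_sets B)" by blast
  qed
qed

lemma side_rel_segments: "side_rel B \<subseteq> segments B \<times> segments B"
proof -
  have "Suc i mod length w < length w" if "i < length w" for i
    using that by (intro mod_less_divisor) auto
  then show ?thesis
    by (fastforce simp: side_rel_def segments_eq arcs_eq seg_before_def seg_after_def rot)
qed

text \<open>Saturated sets are counted in two ways: by a choice for each boundary component, and by
  a base label together with a kernel element.\<close>

theorem two_power_boundary_components:
  "2 ^ card (boundary_components B) = 2 * card (null_sets B)"
proof -
  let ?r = "(side_rel B \<union> (side_rel B)\<inverse>)\<^sup>*"
  have "t \<in> segments B" if "(s, t) \<in> ?r" "s \<in> segments B" for s t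
    using that by (induction rule: rtrancl_induct) (use side_rel_segments in auto)
  then have "?r `` segments B \<subseteq> segments B" by auto
  then have "2 ^ card (boundary_components B) = card {X. X \<subseteq> segments B \<and> saturated X}"
    unfolding boundary_components_def saturated_def
    by (subst card_saturated_subsets[symmetric])
      (auto simp: equiv_rtrancl_symcl saturated_rtrancl_iff segments_eq)
  also have "\<dots> = card ((UNIV :: bool set) \<times> null_sets B)"
    using bij_betw_same_card[OF bij_betw_labelling] by simp
  finally show ?thesis by (simp add: card_cartesian_product)
qed

end

section \<open>From partial Petrials to arbitrary twisted sets\<close>

text \<open>Half-twists leave the rotation unchanged, so one vertex and one word, fixed before
  \<open>T\<close>, serve every twisted set.\<close>

lemma bouquet_imp_one_vertex:
  assumes "bouquet B"
  obtains v w where "\<And>T. one_vertex (B\<lparr>twisted := T\<rparr>) v w"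
proof -
  obtain v where v: "verts B = {v}"
    using assms by (auto simp: bouquet_def card_1_singleton_iff)
  have "card {i. i < length (rot B v) \<and> rot B v ! i = e} = 2" if "e \<in> set (rot B v)" for e
  proof -
    have "card (arcs B e) = 2"
      using assms that v by (auto simp: bouquet_def ribbon_graph_def edges_def)
    moreover have "arcs B e = Pair v ` {i. i < length (rot B v) \<and> rot B v ! i = e}"
      by (auto simp: arcs_def v)
    ultimately show ?thesis by (simp add: card_image inj_on_def)
  qed
  then have "one_vertex (B\<lparr>twisted := T\<rparr>) v (rot B v)" for T
    by unfold_locales (simp_all add: v)
  then show ?thesis using that by blast
qed

lemma edges_twisted_update [simp]: "edges (B\<lparr>twisted := T\<rparr>) = edges B"
  by (simp add: edges_def)

lemma interlaced_twisted_update [simp]: "interlaced (B\<lparr>twisted := T\<rparr>) = interlaced B"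
  by (simp add: interlaced_def fun_eq_iff)

lemma euler_genus_bouquet:
  assumes "bouquet B"
  shows "euler_genus (B\<lparr>twisted := T\<rparr>) =
    1 + int (card (edges B)) - int (card (boundary_components (B\<lparr>twisted := T\<rparr>)))"
proof -
  obtain v where "verts B = {v}"
    using assms by (auto simp: bouquet_def card_1_singleton_iff)
  then show ?thesis
    by (simp add: euler_genus_def connected_components_def quotient_def)
qed

text \<open>Symmetric difference with \<open>twisted G\<close> is an involution of the power set of
  the edges, so the original twists drop out of the sum.\<close>

lemma partial_petrial_poly_alt:
  assumes "twisted G \<subseteq> edges G"
  shows "partial_petrial_poly G =
    (\<Sum>T\<in>Pow (edges G). monom 1 (nat (euler_genus (G\<lparr>twisted := T\<rparr>))))"
  unfolding partial_petrial_poly_def partial_petrial_def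
  by (rule sum.reindex_bij_witness[where i = "\<lambda>A. (twisted G - A) \<union> (A - twisted G)"
        and j = "\<lambda>A. (twisted G - A) \<union> (A - twisted G)"])
    (use assms in \<open>auto intro!: arg_cong[where f = "\<lambda>T. monom 1 (nat (euler_genus (G\<lparr>twisted := T\<rparr>)))"]\<close>)

section \<open>Transport along an isomorphism of intersection graphs\<close>

lemma edge_intersection_graph_iff:
  "{e, f} \<in> snd (intersection_graph B) \<longleftrightarrow> interlaced B e f"
proof
  assume "{e, f} \<in> snd (intersection_graph B)"
  then show "interlaced B e f"
    using interlaced_commute[of B e f] by (auto simp: intersection_graph_def doubleton_eq_iff)
next
  assume "interlaced B e f"
  then show "{e, f} \<in> snd (intersection_graph B)"
    using interlaced_imp_edges[of B e f] unfolding intersection_graph_def by auto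
qed

text \<open>An isomorphism only matches the families of graph edges; injectivity of \<phi> on
  \<open>edges B1\<close> recovers a pair from its image.\<close>

lemma graph_isomorphism_interlaced:
  assumes iso: "graph_isomorphism \<phi> (intersection_graph B1) (intersection_graph B2)"
    and ef: "e \<in> edges B1" "f \<in> edges B1"
  shows "interlaced B2 (\<phi> e) (\<phi> f) \<longleftrightarrow> interlaced B1 e f"
proof -
  let ?S = "\<lambda>B. snd (intersection_graph B)"
  have inj: "inj_on \<phi> (edges B1)" and S2: "?S B2 = (\<lambda>x. \<phi> ` x) ` ?S B1"
    using iso by (auto simp: graph_isomorphism_def intersection_graph_def bij_betw_def)
  have sub: "x \<subseteq> edges B1" if "x \<in> ?S B1" for x
    using that by (auto simp: intersection_graph_def)
  have "interlaced B2 (\<phi> e) (\<phi> f) \<longleftrightarrow> \<phi> ` {e, f} \<in> (\<lambda>x. \<phi> ` x) ` ?S B1"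
    by (simp add: edge_intersection_graph_iff[symmetric] S2)
  also have "\<dots> \<longleftrightarrow> {e, f} \<in> ?S B1"
  proof
    assume "\<phi> ` {e, f} \<in> (\<lambda>x. \<phi> ` x) ` ?S B1"
    then obtain x where x: "x \<in> ?S B1" "\<phi> ` {e, f} = \<phi> ` x" by (rule imageE)
    then have "{e, f} = x"
      using inj_on_image_eq_iff[OF inj, of "{e, f}" x] sub[of x] ef by blast
    then show "{e, f} \<in> ?S B1" using x by simp
  qed blast
  finally show ?thesis by (simp add: edge_intersection_graph_iff)
qed

lemma card_null_sets_isomorphic:
  assumes iso: "graph_isomorphism \<phi> (intersection_graph B1) (intersection_graph B2)"
    and T: "T \<subseteq> edges B1"
  shows "card (null_sets (B2\<lparr>twisted := \<phi> ` T\<rparr>)) = card (null_sets (B1\<lparr>twisted := T\<rparr>))"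
proof -
  have inj: "inj_on \<phi> (edges B1)" and img: "\<phi> ` edges B1 = edges B2"
    using iso by (auto simp: graph_isomorphism_def intersection_graph_def bij_betw_def)
  have null: "\<phi> ` Y \<in> null_sets (B2\<lparr>twisted := \<phi> ` T\<rparr>) \<longleftrightarrow> Y \<in> null_sets (B1\<lparr>twisted := T\<rparr>)"
    if Y: "Y \<subseteq> edges B1" for Y
  proof -
    have "card {f \<in> \<phi> ` Y. interlaced B2 (\<phi> e) f} = card {f \<in> Y. interlaced B1 e f}"
      if e: "e \<in> edges B1" for e
    proof -
      have "{f \<in> \<phi> ` Y. interlaced B2 (\<phi> e) f} = \<phi> ` {f \<in> Y. interlaced B1 e f}"
        using graph_isomorphism_interlaced[OF iso e] Y by blast
      moreover have "inj_on \<phi> {f \<in> Y. interlaced B1 e f}"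
        using Y by (intro inj_on_subset[OF inj]) auto
      ultimately show ?thesis by (simp add: card_image)
    qed
    moreover have "\<phi> e \<in> \<phi> ` Z \<longleftrightarrow> e \<in> Z" if "e \<in> edges B1" "Z \<subseteq> edges B1" for e Z
      using inj_on_image_mem_iff[OF inj that] .
    ultimately show ?thesis
      using Y T by (simp add: null_sets_def img[symmetric] image_mono)
  qed
  have "null_sets (B2\<lparr>twisted := \<phi> ` T\<rparr>) = (\<lambda>Y. \<phi> ` Y) ` null_sets (B1\<lparr>twisted := T\<rparr>)"
  proof (intro equalityI subsetI)
    fix Z assume Z: "Z \<in> null_sets (B2\<lparr>twisted := \<phi> ` T\<rparr>)"
    then have "Z \<subseteq> \<phi> ` edges B1" by (simp add: null_sets_def img)
    then obtain Y where "Y \<subseteq> edges B1" "Z = \<phi> ` Y" by (auto simp: subset_image_iff)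
    then show "Z \<in> (\<lambda>Y. \<phi> ` Y) ` null_sets (B1\<lparr>twisted := T\<rparr>)"
      using Z null by blast
  next
    fix Z assume "Z \<in> (\<lambda>Y. \<phi> ` Y) ` null_sets (B1\<lparr>twisted := T\<rparr>)"
    then obtain Y where "Y \<in> null_sets (B1\<lparr>twisted := T\<rparr>)" "Z = \<phi> ` Y" by blast
    then show "Z \<in> null_sets (B2\<lparr>twisted := \<phi> ` T\<rparr>)"
      using null[of Y] by (simp add: null_sets_def)
  qed
  moreover have "inj_on (\<lambda>Y. \<phi> ` Y) (null_sets (B1\<lparr>twisted := T\<rparr>))"
    by (rule inj_on_subset[OF inj_on_image_Pow[OF inj]]) (auto simp: null_sets_def)
  ultimately show ?thesis by (simp add: card_image)
qed

text \<open>Equal kernel sizes give equal powers of two, hence equally many boundary components; the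
  edge numbers agree because \<phi> is a bijection.\<close>

lemma euler_genus_isomorphic:
  assumes B: "bouquet B1" "bouquet B2"
    and iso: "graph_isomorphism \<phi> (intersection_graph B1) (intersection_graph B2)"
    and T: "T \<subseteq> edges B1"
  shows "euler_genus (B2\<lparr>twisted := \<phi> ` T\<rparr>) = euler_genus (B1\<lparr>twisted := T\<rparr>)"
proof -
  obtain v1 w1 where 1: "\<And>T. one_vertex (B1\<lparr>twisted := T\<rparr>) v1 w1"
    using bouquet_imp_one_vertex[OF B(1)] by blast
  obtain v2 w2 where 2: "\<And>T. one_vertex (B2\<lparr>twisted := T\<rparr>) v2 w2"
    using bouquet_imp_one_vertex[OF B(2)] by blast
  have "(2 :: nat) ^ card (boundary_components (B2\<lparr>twisted := \<phi> ` T\<rparr>)) =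
      2 ^ card (boundary_components (B1\<lparr>twisted := T\<rparr>))"
    using one_vertex.two_power_boundary_components[OF 1]
      one_vertex.two_power_boundary_components[OF 2] card_null_sets_isomorphic[OF iso T]
    by simp
  then have "card (boundary_components (B2\<lparr>twisted := \<phi> ` T\<rparr>)) =
      card (boundary_components (B1\<lparr>twisted := T\<rparr>))"
    by simp
  moreover have "card (edges B1) = card (edges B2)"
    using iso by (auto simp: graph_isomorphism_def intersection_graph_def dest: bij_betw_same_card)
  ultimately show ?thesis
    by (simp add: euler_genus_bouquet B)
qed

theorem theorem2p4:
  fixes B1 :: "('v, 'a) rgraph" and B2 :: "('w, 'b) rgraph" and \<phi> :: "'a \<Rightarrow> 'b"
  assumes "bouquet B1" and "bouquet B2"
    and "graph_isomorphism \<phi> (intersection_graph B1) (intersection_graph B2)"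
  shows "partial_petrial_poly B1 = partial_petrial_poly B2"
proof -
  have "bij_betw \<phi> (edges B1) (edges B2)"
    using assms(3) by (simp add: graph_isomorphism_def intersection_graph_def)
  then have bij: "bij_betw (\<lambda>T. \<phi> ` T) (Pow (edges B1)) (Pow (edges B2))"
    by (rule bij_betw_Pow)
  \<comment> \<open>Nothing relates the twists of the two bouquets, so both polynomials are
    rewritten as sums over all twisted sets, which \<phi> matches.\<close>
  have "partial_petrial_poly B1 =
      (\<Sum>T\<in>Pow (edges B1). monom 1 (nat (euler_genus (B1\<lparr>twisted := T\<rparr>))))"
    using assms(1) by (intro partial_petrial_poly_alt) (simp add: bouquet_def ribbon_graph_def)
  also have "\<dots> = (\<Sum>T\<in>Pow (edges B1). monom 1 (nat (euler_genus (B2\<lparr>twisted := \<phi> ` T\<rparr>))))"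
    using euler_genus_isomorphic[OF assms] by (intro sum.cong) auto
  also have "\<dots> = (\<Sum>T\<in>Pow (edges B2). monom 1 (nat (euler_genus (B2\<lparr>twisted := T\<rparr>))))"
    by (rule sum.reindex_bij_betw[OF bij])
  also have "\<dots> = partial_petrial_poly B2"
    using assms(2) by (intro partial_petrial_poly_alt[symmetric])
      (simp add: bouquet_def ribbon_graph_def)
  finally show ?thesis .
qed

end
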